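(* Let $p_X, p_Y \in [0,1]$ and let $\delta \ge 0$ be a fixed integer (not depending on $T$). Let $(X_i)_{i\ge 1}$ and $(Y_j)_{j \ge 1}$ be two independent sequences of random variables, where the $X_i$ are i.i.d. Bernoulli($p_X$) and the $Y_j$ are i.i.d. Bernoulli($p_Y$). For each positive integer $T$ let $$S_{T,\delta} = \{(i,j) \in \{1,\dots,T\}^2 : |i-j| \le \delta,\ X_i = Y_j = 1\}$$ and let $|S_{T,\delta}|$ be its cardinality. Then, as $T \to \infty$, $$\frac{|S_{T,\delta}| - \mathbb{E}(|S_{T,\delta}|)}{\sqrt{T}} \longrightarrow Z \sim \mathcal{N}(0,\sigma_\delta^2)$$ in distribution, where $$\sigma_\delta^2 = (2\delta+1)\,p_X p_Y (1 - p_X p_Y) + 2\delta(2\delta+1)\, p_X p_Y \big( p_Y(1-p_X) + p_X(1-p_Y)\big).$$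
   Context: $\mathcal{N}(0,\sigma^2)$ denotes the normal distribution with mean $0$ and variance $\sigma^2$; if $\sigma^2 = 0$ it is interpreted as the point mass at $0$. Bernoulli($p$) random variables take value $1$ with probability $p$ and $0$ with probability $1-p$. *)

theory Defs
  imports "HOL-Probability.Probability"
begin

definition bernoulli_rv :: "'a measure \<Rightarrow> real \<Rightarrow> ('a \<Rightarrow> real) \<Rightarrow> bool" where
  "bernoulli_rv M p X \<longleftrightarrow>
     X \<in> borel_measurable M \<and>
     measure M {\<omega> \<in> space M. X \<omega> = 1} = p \<and>
     measure M {\<omega> \<in> space M. X \<omega> = 0} = 1 - p"

text \<open>Sequences are indexed from 1; the value at index 0 is irrelevant.\<close>

definition iid_bernoulli :: "'a measure \<Rightarrow> real \<Rightarrow> (nat \<Rightarrow> 'a \<Rightarrow> real) \<Rightarrow> bool" where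
  "iid_bernoulli M p X \<longleftrightarrow>
     prob_space.indep_vars M (\<lambda>_. borel) X {1..} \<and> (\<forall>i\<ge>1. bernoulli_rv M p (X i))"

text \<open>Independence of the sequences as random elements of the product space, that is,
  of the sigma-algebras they generate.\<close>

definition indep_seqs :: "'a measure \<Rightarrow> (nat \<Rightarrow> 'a \<Rightarrow> real) \<Rightarrow> (nat \<Rightarrow> 'a \<Rightarrow> real) \<Rightarrow> bool" where
  "indep_seqs M X Y \<longleftrightarrow>
     prob_space.indep_var M
       (PiM {1..} (\<lambda>_. borel)) (\<lambda>\<omega>. \<lambda>i\<in>{1..}. X i \<omega>)
       (PiM {1..} (\<lambda>_. borel)) (\<lambda>\<omega>. \<lambda>j\<in>{1..}. Y j \<omega>)"

definition S_set ::
  "(nat \<Rightarrow> 'a \<Rightarrow> real) \<Rightarrow> (nat \<Rightarrow> 'a \<Rightarrow> real) \<Rightarrow> nat \<Rightarrow> nat \<Rightarrow> 'a \<Rightarrow> (nat \<times> nat) set" where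
  "S_set X Y T \<delta> \<omega> =
     {(i, j) \<in> {1..T} \<times> {1..T}. \<bar>int i - int j\<bar> \<le> int \<delta> \<and> X i \<omega> = 1 \<and> Y j \<omega> = 1}"

definition sigma_sq :: "real \<Rightarrow> real \<Rightarrow> nat \<Rightarrow> real" where
  "sigma_sq pX pY \<delta> =
     (2 * real \<delta> + 1) * pX * pY * (1 - pX * pY) +
     2 * real \<delta> * (2 * real \<delta> + 1) * pX * pY * (pY * (1 - pX) + pX * (1 - pY))"

text \<open>The parameter \<open>v\<close> is the variance, whereas \<^const>\<open>normal_density\<close>
  takes the standard deviation and does not cover the degenerate case.\<close>

definition centered_normal :: "real \<Rightarrow> real measure" where
  "centered_normal v =
     (if v = 0 then return borel 0 else density lborel (normal_density 0 (sqrt v)))"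

end

theory Submission
  imports Defs
begin

text \<open>Centred hits \<open>X\<^sub>i Y\<^sub>j - p\<^sub>X p\<^sub>Y\<close> are dependent only when they share \<open>X\<^sub>i\<close> or \<open>Y\<^sub>j\<close>, and near the diagonal
each of these variables occurs in at most \<open>2\<delta> + 1\<close> terms. The sum of these terms is therefore a sum with dependence of finite range, and
the proof is Bernstein's block method. The interval \<open>{1..T}\<close> is cut into \<open>n = T div k\<close> blocks of
fixed length \<open>k\<close>, and only pairs with both indices in the same block are kept. The block sums are
independent (\<open>block_devs_indep\<close>) and identically distributed (\<open>distr_total_dev_window\<close>), so
the classical central limit theorem applies to them for fixed \<open>k\<close>.

The rest is a computation of second moments. The covariance of two hits splits into a part for a
common row, a part for a common column and a nonnegative part for coinciding pairs
(\<open>prob_two_hits\<close>). Counting rows and columns near the diagonal then shows two things. A set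
of pairs contributes at most proportionally to its size (\<open>total_dev_second_moment_le\<close>); since a
block boundary is straddled by a number of pairs that is bounded independently of \<open>k\<close>, the discarded pairs cost
only \<open>O(1/k)\<close> after normalisation (\<open>block_approximation\<close>). And a block of length \<open>k\<close> has second
moment between \<open>(k - 4\<delta>) \<sigma>\<^sup>2\<close> and \<open>k \<sigma>\<^sup>2\<close>, with \<open>\<sigma>\<^sup>2\<close> the claimed variance
(\<open>window_second_moment_ge\<close>, \<open>window_second_moment_le\<close>), so the block variance per unit length tends to
\<open>\<sigma>\<^sup>2\<close> as \<open>k\<close> grows.

Characteristic functions combine the two limits: they turn the second moment of the error into a
uniform error (\<open>norm_char_diff_le\<close>), they allow first \<open>T\<close> and then \<open>k\<close> to tend to infinity
(\<open>tendsto_by_approximation\<close>), and convergence in distribution follows from Levy's continuity theorem.\<close>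

section \<open>Characteristic functions\<close>

lemma char_distr_eq:
  assumes "F \<in> borel_measurable M"
  shows "char (distr M borel F) t = (CLINT \<omega>|M. iexp (t * F \<omega>))"
  unfolding char_def using assms by (subst integral_distr) auto

lemma norm_iexp_diff_le: "cmod (iexp x - iexp y) \<le> \<bar>x - y\<bar>"
proof -
  have "iexp x - iexp y = iexp y * (iexp (x - y) - 1)"
    by (simp add: right_diff_distrib flip: exp_add)
  then have "cmod (iexp x - iexp y) = cmod (iexp (x - y) - 1)"
    by (simp add: norm_mult)
  also have "\<dots> \<le> \<bar>x - y\<bar>"
    using iexp_approx1[of "x - y" 0] by simp
  finally show ?thesis .
qed

text \<open>Characteristic functions are Lipschitz with respect to the \<open>L\<^sup>1\<close> distance of the random
variables, which the \<open>L\<^sup>2\<close> distance dominates. Every error term of the block argument enters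
through this bound, so that only second moments have to be controlled.\<close>

lemma (in prob_space) norm_char_diff_le:
  assumes [measurable]: "F \<in> borel_measurable M" "G \<in> borel_measurable M"
    and int: "integrable M (\<lambda>\<omega>. (F \<omega> - G \<omega>)\<^sup>2)"
    and le: "expectation (\<lambda>\<omega>. (F \<omega> - G \<omega>)\<^sup>2) \<le> e"
  shows "cmod (char (distr M borel F) t - char (distr M borel G) t) \<le> \<bar>t\<bar> * sqrt e"
proof -
  let ?H = "\<lambda>\<omega>. \<bar>F \<omega> - G \<omega>\<bar>"
  have intH: "integrable M ?H"
    by (rule square_integrable_imp_integrable) (use int in simp_all)
  have iF: "integrable M (\<lambda>\<omega>. iexp (t * F \<omega>))" and iG: "integrable M (\<lambda>\<omega>. iexp (t * G \<omega>))"
    by (auto intro!: integrable_iexp)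
  have "(expectation ?H)\<^sup>2 \<le> expectation (\<lambda>\<omega>. (?H \<omega>)\<^sup>2)"
    using variance_positive[of ?H] variance_eq[OF intH] int by simp
  then have "(expectation ?H)\<^sup>2 \<le> e"
    using le by simp
  then have "expectation ?H \<le> sqrt e"
    by (rule real_le_rsqrt)
  moreover have "cmod (char (distr M borel F) t - char (distr M borel G) t)
      = cmod (CLINT \<omega>|M. iexp (t * F \<omega>) - iexp (t * G \<omega>))"
    by (simp only: char_distr_eq assms(1,2) Bochner_Integration.integral_diff[OF iF iG])
  moreover have "\<dots> \<le> expectation (\<lambda>\<omega>. cmod (iexp (t * F \<omega>) - iexp (t * G \<omega>)))"
    by (rule integral_norm_bound)
  moreover have "\<dots> \<le> expectation (\<lambda>\<omega>. \<bar>t\<bar> * ?H \<omega>)"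
  proof (rule integral_mono)
    show "integrable M (\<lambda>\<omega>. cmod (iexp (t * F \<omega>) - iexp (t * G \<omega>)))"
      using iF iG by auto
    show "integrable M (\<lambda>\<omega>. \<bar>t\<bar> * ?H \<omega>)"
      using intH by simp
    show "cmod (iexp (t * F \<omega>) - iexp (t * G \<omega>)) \<le> \<bar>t\<bar> * ?H \<omega>" for \<omega>
      using norm_iexp_diff_le[of "t * F \<omega>" "t * G \<omega>"]
      by (simp flip: abs_mult right_diff_distrib)
  qed
  moreover have "\<dots> = \<bar>t\<bar> * expectation ?H"
    by simp
  ultimately show ?thesis
    by (smt (verit) abs_ge_zero mult_left_mono)
qed

text \<open>The classical central limit theorem, normalised by \<open>sqrt n\<close> only, so that the degenerate case
\<open>v = 0\<close> is included: then all summands vanish almost surely. That case occurs: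
if a success probability is \<open>0\<close>, there are no hits at all.\<close>

lemma (in prob_space) char_iid_sum_tendsto:
  fixes V :: "nat \<Rightarrow> 'a \<Rightarrow> real"
  assumes indep: "indep_vars (\<lambda>_. borel) V UNIV"
    and mean: "\<And>n. expectation (V n) = 0"
    and int: "\<And>n. integrable M (\<lambda>\<omega>. (V n \<omega>)\<^sup>2)"
    and var: "\<And>n. expectation (\<lambda>\<omega>. (V n \<omega>)\<^sup>2) = v"
    and distr: "\<And>n. distr M borel (V n) = \<mu>"
  shows "(\<lambda>n. char (distr M borel (\<lambda>\<omega>. (\<Sum>i<n. V i \<omega>) / sqrt n)) t)
           \<longlonglongrightarrow> complex_of_real (exp (- (v * t\<^sup>2) / 2))"
proof -
  have [measurable]: "V n \<in> borel_measurable M" for n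
    using indep by (simp add: indep_vars_def2)
  have "v \<ge> 0"
    unfolding var[of 0, symmetric] by simp
  then consider "v = 0" | "v > 0" by linarith
  then show ?thesis
  proof cases
    case 1
    have "AE \<omega> in M. V n \<omega> = 0" for n
      using integral_nonneg_eq_0_iff_AE[OF int[of n]] var[of n] 1 by simp
    then have "AE \<omega> in M. \<forall>n. V n \<omega> = 0"
      by (simp add: AE_all_countable)
    then have "char (distr M borel (\<lambda>\<omega>. (\<Sum>i<n. V i \<omega>) / sqrt n)) t = (CLINT \<omega>|M. 1)" for n
      unfolding char_distr_eq[OF borel_measurable_divide[OF borel_measurable_sum borel_measurable_const], OF \<open>V _ \<in> _\<close>]
      by (intro integral_cong_AE) auto
    then show ?thesis
      using 1 by (simp add: prob_space)
  next
    case 2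
    have "weak_conv_m (\<lambda>n. distr M borel (\<lambda>\<omega>. (\<Sum>i<n. V i \<omega>) / sqrt (n * (sqrt v)\<^sup>2)))
            std_normal_distribution"
      by (rule central_limit_theorem_zero_mean[OF indep mean _ int _ distr])
        (use 2 mean var in simp_all)
    then have "(\<lambda>n. char (distr M borel (\<lambda>\<omega>. (\<Sum>i<n. V i \<omega>) / sqrt (n * (sqrt v)\<^sup>2))) (sqrt v * t))
        \<longlonglongrightarrow> char std_normal_distribution (sqrt v * t)"
      by (intro levy_continuity1 real_distribution_distr)
        (auto simp: real_dist_normal_dist)
    moreover have "char (distr M borel (\<lambda>\<omega>. (\<Sum>i<n. V i \<omega>) / sqrt (n * (sqrt v)\<^sup>2))) (sqrt v * t)
        = char (distr M borel (\<lambda>\<omega>. (\<Sum>i<n. V i \<omega>) / sqrt n)) t" for n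
    proof -
      have "sqrt v * t * (x / sqrt (n * (sqrt v)\<^sup>2)) = t * (x / sqrt n)" for x
        using 2 by (simp add: real_sqrt_mult)
      then show ?thesis
        by (subst (1 2) char_distr_eq) simp_all
    qed
    ultimately show ?thesis
      using 2 by (simp add: char_std_normal_distribution power_mult_distrib)
  qed
qed

text \<open>The two-parameter limit behind the block argument: first \<open>n \<longlonglongrightarrow> \<infinity>\<close> for a fixed
block length \<open>k\<close>, then \<open>k \<longlonglongrightarrow> \<infinity>\<close>. The error \<open>e k\<close> must be uniform in \<open>n\<close>, but
only for \<open>n\<close> large depending on \<open>k\<close>.\<close>

lemma tendsto_by_approximation:
  fixes \<phi> :: "nat \<Rightarrow> 'b :: metric_space"
  assumes close: "\<And>k. k > 0 \<Longrightarrow> \<forall>\<^sub>F n in sequentially. dist (\<phi> n) (\<psi> k n) \<le> e k"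
    and conv: "\<And>k. k > 0 \<Longrightarrow> \<psi> k \<longlonglongrightarrow> L k"
    and e: "e \<longlonglongrightarrow> (0::real)" and L: "L \<longlonglongrightarrow> l"
  shows "\<phi> \<longlonglongrightarrow> l"
proof (rule tendstoI)
  fix \<epsilon> :: real assume "\<epsilon> > 0"
  then have "\<forall>\<^sub>F k in sequentially. e k < \<epsilon> / 3" "\<forall>\<^sub>F k in sequentially. dist (L k) l < \<epsilon> / 3"
    using order_tendstoD(2)[OF e, of "\<epsilon>/3"] tendstoD[OF L, of "\<epsilon>/3"] by auto
  with eventually_gt_at_top[of "0::nat"]
  have "\<forall>\<^sub>F k in sequentially. 0 < k \<and> e k < \<epsilon> / 3 \<and> dist (L k) l < \<epsilon> / 3"
    by eventually_elim simp
  then obtain k where k: "0 < k" "e k < \<epsilon> / 3" "dist (L k) l < \<epsilon> / 3"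
    using eventually_happens'[OF sequentially_bot] by blast
  from close[OF k(1)] tendstoD[OF conv[OF k(1)], of "\<epsilon>/3"]
  have "\<forall>\<^sub>F n in sequentially. dist (\<phi> n) (\<psi> k n) \<le> e k \<and> dist (\<psi> k n) (L k) < \<epsilon> / 3"
    using \<open>\<epsilon> > 0\<close> by (auto elim: eventually_elim2)
  then show "\<forall>\<^sub>F n in sequentially. dist (\<phi> n) l < \<epsilon>"
  proof eventually_elim
    case (elim n)
    have "dist (\<phi> n) l \<le> dist (\<phi> n) (\<psi> k n) + dist (\<psi> k n) (L k) + dist (L k) l"
      by (meson dist_triangle dist_triangle_le add_mono order_refl order_trans)
    with elim k show ?case by linarith
  qed
qed

lemma real_distribution_centered_normal: "v \<ge> 0 \<Longrightarrow> real_distribution (centered_normal v)"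
  unfolding centered_normal_def
  by (auto simp: real_distribution_def real_distribution_axioms_def
      intro!: prob_space_normal_density prob_space_return)

lemma char_centered_normal:
  assumes "v \<ge> 0"
  shows "char (centered_normal v) t = complex_of_real (exp (- (v * t\<^sup>2) / 2))"
proof (cases "v = 0")
  case True
  then show ?thesis
    by (simp add: centered_normal_def char_def integral_return)
next
  case False
  with assms have "v > 0" by simp
  interpret N: prob_space "density lborel std_normal_density"
    by (rule prob_space_normal_density) simp
  have "distributed (density lborel std_normal_density) lborel (\<lambda>x. x) std_normal_density"
    by (auto simp: distributed_def distr_id2)
  from N.normal_density_affine[OF this, of "sqrt v" 0]
  have "distr (density lborel std_normal_density) lborel (\<lambda>x. sqrt v * x)
      = density lborel (normal_density 0 (sqrt v))"
    using \<open>v > 0\<close> by (simp add: distributed_def)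
  then have "centered_normal v = distr (density lborel std_normal_density) borel (\<lambda>x. sqrt v * x)"
    using False by (simp add: centered_normal_def cong: distr_cong)
  then have "char (centered_normal v) t = char std_normal_distribution (t * sqrt v)"
    by (simp add: char_distr_eq) (simp add: char_def mult_ac)
  then show ?thesis
    using \<open>v > 0\<close> by (simp add: char_std_normal_distribution power_mult_distrib mult_ac)
qed

section \<open>Pairs near the diagonal\<close>

definition window :: "nat \<Rightarrow> nat \<Rightarrow> nat \<Rightarrow> (nat \<times> nat) set" where
  "window \<delta> m n = {(i, j) \<in> {m<..m+n} \<times> {m<..m+n}. \<bar>int i - int j\<bar> \<le> int \<delta>}"

text \<open>The pairs whose first index keeps distance \<open>2\<delta>\<close> from both ends. The second index then keeps
distance \<open>\<delta>\<close>, so both the row and the column through such a pair are complete and have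
\<open>2\<delta> + 1\<close> elements. If \<open>n \<le> 4\<delta>\<close> there are none, in accordance with truncated
subtraction.\<close>

definition core :: "nat \<Rightarrow> nat \<Rightarrow> nat \<Rightarrow> (nat \<times> nat) set" where
  "core \<delta> m n = (SIGMA i:{m + 2 * \<delta><..m + n - 2 * \<delta>}. {i - \<delta>..i + \<delta>})"

lemma finite_window [simp]: "finite (window \<delta> m n)"
  by (rule finite_subset[of _ "{m<..m+n} \<times> {m<..m+n}"]) (auto simp: window_def)

lemma core_subset_window: "core \<delta> m n \<subseteq> window \<delta> m n"
  by (auto simp: core_def window_def)

lemma card_core: "card (core \<delta> m n) = (2 * \<delta> + 1) * (n - 4 * \<delta>)"
proof -
  have "card (core \<delta> m n) = (\<Sum>i\<in>{m + 2 * \<delta><..m + n - 2 * \<delta>}. card {i - \<delta>..i + \<delta>})"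
    unfolding core_def by (rule card_SigmaI) auto
  also have "\<dots> = (\<Sum>i\<in>{m + 2 * \<delta><..m + n - 2 * \<delta>}. 2 * \<delta> + 1)"
    by (rule sum.cong) auto
  finally show ?thesis by simp
qed

lemma card_row_le:
  assumes "R \<subseteq> window \<delta> m n"
  shows "card {y \<in> R. fst y = i} \<le> 2 * \<delta> + 1"
proof -
  have "card {y \<in> R. fst y = i} \<le> card (Pair i ` {i - \<delta>..i + \<delta>})"
    by (intro card_mono) (auto simp: window_def image_iff dest!: subsetD[OF assms])
  also have "\<dots> \<le> card {i - \<delta>..i + \<delta>}"
    by (rule card_image_le) simp
  finally show ?thesis by simp
qed

lemma card_col_le:
  assumes "R \<subseteq> window \<delta> m n"
  shows "card {y \<in> R. snd y = j} \<le> 2 * \<delta> + 1"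
proof -
  have "card {y \<in> R. snd y = j} \<le> card ((\<lambda>i. (i, j)) ` {j - \<delta>..j + \<delta>})"
    by (intro card_mono) (auto simp: window_def image_iff dest!: subsetD[OF assms])
  also have "\<dots> \<le> card {j - \<delta>..j + \<delta>}"
    by (rule card_image_le) simp
  finally show ?thesis by simp
qed

lemma card_row_core:
  assumes "x \<in> core \<delta> m n"
  shows "card {y \<in> window \<delta> m n. fst y = fst x} = 2 * \<delta> + 1"
proof -
  have "{y \<in> window \<delta> m n. fst y = fst x} = Pair (fst x) ` {fst x - \<delta>..fst x + \<delta>}"
    using assms by (auto simp: window_def core_def image_iff)
  moreover have "fst x \<ge> \<delta>" using assms by (auto simp: core_def)
  ultimately show ?thesis
    by (simp add: card_image inj_on_def)
qed

lemma card_col_core: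
  assumes "x \<in> core \<delta> m n"
  shows "card {y \<in> window \<delta> m n. snd y = snd x} = 2 * \<delta> + 1"
proof -
  have "{y \<in> window \<delta> m n. snd y = snd x} = (\<lambda>i. (i, snd x)) ` {snd x - \<delta>..snd x + \<delta>}"
    using assms by (auto simp: window_def core_def image_iff)
  moreover have "snd x \<ge> \<delta>" using assms by (auto simp: core_def)
  ultimately show ?thesis
    by (simp add: card_image inj_on_def)
qed

lemma card_window_le: "card (window \<delta> m n) \<le> (2 * \<delta> + 1) * n"
proof -
  have "window \<delta> m n = (\<Union>i\<in>{m<..m+n}. {y \<in> window \<delta> m n. fst y = i})"
    by (auto simp: window_def)
  then have "card (window \<delta> m n) \<le> (\<Sum>i\<in>{m<..m+n}. card {y \<in> window \<delta> m n. fst y = i})"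
    by (metis card_UN_le finite_greaterThanAtMost)
  also have "\<dots> \<le> (\<Sum>i\<in>{m<..m+n}. 2 * \<delta> + 1)"
    by (intro sum_mono card_row_le[OF order_refl])
  finally show ?thesis by (simp add: algebra_simps)
qed

lemma card_window_ge: "(2 * \<delta> + 1) * (n - 4 * \<delta>) \<le> card (window \<delta> m n)"
  using card_mono[OF finite_window core_subset_window] card_core by metis

lemma window_shift: "window \<delta> m n = (\<lambda>(i, j). (m + i, m + j)) ` window \<delta> 0 n"
proof (intro equalityI subsetI)
  fix x assume "x \<in> window \<delta> m n"
  then show "x \<in> (\<lambda>(i, j). (m + i, m + j)) ` window \<delta> 0 n"
    by (intro image_eqI[of _ _ "(fst x - m, snd x - m)"]) (auto simp: window_def)
qed (auto simp: window_def)

lemma block_index_unique: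
  fixes i k b c :: nat
  assumes "i \<in> {b * k<..b * k + k}" "i \<in> {c * k<..c * k + k}"
  shows "b = c"
proof -
  have "b * k < Suc c * k" "c * k < Suc b * k"
    using assms by auto
  then show ?thesis
    by (metis Suc_leI less_Suc_eq_le mult_less_cancel2 order_antisym)
qed

lemma blocks_disjoint: "b \<noteq> c \<Longrightarrow> window \<delta> (b * k) k \<inter> window \<delta> (c * k) k = {}"
  using block_index_unique by (fastforce simp: window_def)

lemma blocks_subset:
  assumes "n * k \<le> T"
  shows "(\<Union>b<n. window \<delta> (b * k) k) \<subseteq> window \<delta> 0 T"
proof -
  have "b * k + k \<le> T" if "b < n" for b
  proof -
    have "Suc b * k \<le> n * k" using that by (intro mult_le_mono1) simp
    then show ?thesis using assms by simp
  qed
  then show ?thesis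
    by (fastforce simp: window_def)
qed

text \<open>Cutting \<open>{1..T}\<close> into \<open>n\<close> consecutive blocks of length \<open>k\<close> loses only the pairs with an
index beyond \<open>n * k\<close> and the pairs that straddle a block boundary. Both are counted at once by
comparing the upper bound for the full window with the lower bound for each block; the
loss per boundary does not depend on \<open>k\<close>.\<close>

lemma card_uncovered_pairs:
  assumes "n * k \<le> T"
  shows "real (card (window \<delta> 0 T - (\<Union>b<n. window \<delta> (b * k) k)))
           \<le> (2 * real \<delta> + 1) * (real T - real n * real k + 4 * real \<delta> * real n)"
proof -
  let ?U = "\<Union>b<n. window \<delta> (b * k) k"
  have "card ?U = (\<Sum>b<n. card (window \<delta> (b * k) k))"
    by (rule card_UN_disjoint) (auto simp: blocks_disjoint)
  then have "real (card ?U) = (\<Sum>b<n. real (card (window \<delta> (b * k) k)))"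
    by simp
  also have "\<dots> \<ge> (\<Sum>b<n. (2 * real \<delta> + 1) * (real k - 4 * real \<delta>))"
  proof (rule sum_mono)
    fix b
    have "(2 * real \<delta> + 1) * (real k - 4 * real \<delta>) \<le> (2 * real \<delta> + 1) * real (k - 4 * \<delta>)"
      by (intro mult_left_mono) linarith+
    also have "\<dots> = real ((2 * \<delta> + 1) * (k - 4 * \<delta>))"
      by (simp only: of_nat_mult of_nat_add of_nat_1 of_nat_numeral)
    also have "\<dots> \<le> real (card (window \<delta> (b * k) k))"
      using card_window_ge by (rule of_nat_mono)
    finally show "(2 * real \<delta> + 1) * (real k - 4 * real \<delta>) \<le> real (card (window \<delta> (b * k) k))" .
  qed
  finally have U: "real n * ((2 * real \<delta> + 1) * (real k - 4 * real \<delta>)) \<le> real (card ?U)"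
    by simp
  have "real (card (window \<delta> 0 T)) \<le> real ((2 * \<delta> + 1) * T)"
    using card_window_le by (rule of_nat_mono)
  moreover have "real (card (window \<delta> 0 T - ?U)) = real (card (window \<delta> 0 T)) - real (card ?U)"
    using blocks_subset[OF assms, of \<delta>] by (simp add: card_Diff_subset finite_subset card_mono of_nat_diff)
  ultimately show ?thesis
    using U by (simp add: algebra_simps)
qed

section \<open>Two independent Bernoulli sequences\<close>

lemma (in prob_space) has_expectation_of_bool:
  assumes "Measurable.pred M P"
  shows "integrable M (\<lambda>\<omega>. of_bool (P \<omega>) :: real)"
    and "expectation (\<lambda>\<omega>. of_bool (P \<omega>)) = prob {\<omega> \<in> space M. P \<omega>}"
proof -
  have *: "{\<omega> \<in> space M. P \<omega>} \<in> events"
    using assms by simp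
  have eq: "of_bool (P \<omega>) = (indicator {\<omega> \<in> space M. P \<omega>} \<omega> :: real)" if "\<omega> \<in> space M" for \<omega>
    using that by (auto simp: indicator_def)
  show "integrable M (\<lambda>\<omega>. of_bool (P \<omega>) :: real)"
    using * by (subst Bochner_Integration.integrable_cong[OF refl eq]) (auto simp: emeasure_eq_measure)
  show "expectation (\<lambda>\<omega>. of_bool (P \<omega>)) = prob {\<omega> \<in> space M. P \<omega>}"
    using * by (subst Bochner_Integration.integral_cong[OF refl eq]) auto
qed

text \<open>Independence within each of two families together with independence of the two families as wholes
is independence of the union: the probability of a finite intersection first factors
into the two families, and then each factor splits further. The union is indexed by pairs
with a Boolean tag, so that a block of both sequences becomes a subset of a single index set.\<close>

lemma (in prob_space) indep_vars_combine:
  fixes W :: "bool \<times> 'i \<Rightarrow> 'a \<Rightarrow> 'b"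
  assumes each: "\<And>s. indep_vars (\<lambda>_. N) (\<lambda>i. W (s, i)) I"
    and joint: "indep_var (PiM I (\<lambda>_. N)) (\<lambda>\<omega>. \<lambda>i\<in>I. W (True, i) \<omega>)
                          (PiM I (\<lambda>_. N)) (\<lambda>\<omega>. \<lambda>i\<in>I. W (False, i) \<omega>)"
  shows "indep_vars (\<lambda>_. N) W (UNIV \<times> I)"
  unfolding indep_vars_def2
proof (intro conjI indep_setsI)
  have rv: "random_variable N (W x)" if "x \<in> UNIV \<times> I" for x
    using each[of "fst x"] that by (auto simp: indep_vars_def2)
  then show "\<forall>x\<in>UNIV \<times> I. random_variable N (W x)" by blast
  show "{W x -` A \<inter> space M |A. A \<in> sets N} \<subseteq> events" if "x \<in> UNIV \<times> I" for x
    using rv[OF that] by auto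
  fix A and J :: "(bool \<times> 'i) set"
  assume J: "J \<noteq> {}" "J \<subseteq> UNIV \<times> I" "finite J"
    and "\<forall>x\<in>J. A x \<in> {W x -` A \<inter> space M |A. A \<in> sets N}"
  then have "\<exists>B. \<forall>x\<in>J. B x \<in> sets N \<and> A x = W x -` B x \<inter> space M"
    by (intro bchoice) auto
  then obtain B where B: "\<And>x. x \<in> J \<Longrightarrow> B x \<in> sets N"
    and A: "\<And>x. x \<in> J \<Longrightarrow> A x = W x -` B x \<inter> space M"
    by blast
  define K where "K s = {i. (s, i) \<in> J}" for s
  have K: "finite (K s)" "K s \<subseteq> I" for s
    using J finite_vimageI[of J "Pair s"] by (auto simp: K_def vimage_def inj_on_def)
  \<comment> \<open>The event \<open>E s\<close> is the contribution of the family with tag \<open>s\<close>; \<open>C s\<close> is the same event in the product space.\<close>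
  define C where "C s = {f \<in> space (PiM I (\<lambda>_. N)). \<forall>i\<in>K s. f i \<in> B (s, i)}" for s
  have C: "C s \<in> sets (PiM I (\<lambda>_. N))" for s
    unfolding C_def
  proof (rule sets.sets_Collect_finite_All)
    show "{f \<in> space (PiM I (\<lambda>_. N)). f i \<in> B (s, i)} \<in> sets (PiM I (\<lambda>_. N))" if "i \<in> K s" for i
    proof (rule measurable_sets_Collect[OF measurable_component_singleton, where P="\<lambda>y. y \<in> B (s, i)"])
      show "i \<in> I" using that K by auto
      show "{x \<in> space N. x \<in> B (s, i)} \<in> sets N"
        using B[of "(s, i)"] that by (simp add: K_def Collect_conj_eq Int_absorb1 sets.sets_into_space)
    qed
  qed (use K in auto)
  define E where "E s = {\<omega> \<in> space M. \<forall>i\<in>K s. W (s, i) \<omega> \<in> B (s, i)}" for s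
  have E: "(\<lambda>\<omega>. \<lambda>i\<in>I. W (s, i) \<omega>) -` C s \<inter> space M = E s" for s
    using rv K[of s] by (fastforce simp: C_def E_def space_PiM dest: measurable_space)
  have probE: "prob (E s) = (\<Prod>i\<in>K s. prob (A (s, i)))" for s
  proof (cases "K s = {}")
    case True
    then show ?thesis by (simp add: E_def prob_space)
  next
    case False
    have "prob (\<Inter>i\<in>K s. W (s, i) -` B (s, i) \<inter> space M)
        = (\<Prod>i\<in>K s. prob (W (s, i) -` B (s, i) \<inter> space M))"
      using each[of s] by (rule indep_varsD) (use False K B in \<open>auto simp: K_def\<close>)
    moreover have "(\<Inter>i\<in>K s. W (s, i) -` B (s, i) \<inter> space M) = E s"
      using False by (auto simp: E_def)
    moreover have "(\<Prod>i\<in>K s. prob (W (s, i) -` B (s, i) \<inter> space M)) = (\<Prod>i\<in>K s. prob (A (s, i)))"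
      by (rule prod.cong) (simp_all add: A K_def)
    ultimately show ?thesis by simp
  qed
  have "x \<in> J \<longleftrightarrow> x \<in> Pair True ` K True \<union> Pair False ` K False" for x
    by (cases x, cases "fst x") (auto simp: K_def image_iff)
  then have J_eq: "J = Pair True ` K True \<union> Pair False ` K False"
    by blast
  have "(\<forall>x\<in>J. W x \<omega> \<in> B x) \<longleftrightarrow>
      (\<forall>i\<in>K True. W (True, i) \<omega> \<in> B (True, i)) \<and> (\<forall>i\<in>K False. W (False, i) \<omega> \<in> B (False, i))" for \<omega>
    by (subst J_eq) blast
  moreover have "(\<Inter>x\<in>J. A x) = {\<omega> \<in> space M. \<forall>x\<in>J. W x \<omega> \<in> B x}"
    using J(1) A by auto
  ultimately have "(\<Inter>x\<in>J. A x) = E True \<inter> E False"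
    by (auto simp: E_def)
  also have "\<dots> = (\<lambda>\<omega>. (\<lambda>i\<in>I. W (True, i) \<omega>, \<lambda>i\<in>I. W (False, i) \<omega>)) -` (C True \<times> C False) \<inter> space M"
    unfolding E[symmetric] by auto
  finally have "(\<Inter>x\<in>J. A x) = \<dots>" .
  then have "prob (\<Inter>x\<in>J. A x) = prob (E True) * prob (E False)"
    using indep_varD[OF joint C C, of True False] by (simp add: E)
  also have "\<dots> = (\<Prod>x\<in>Pair True ` K True. prob (A x)) * (\<Prod>x\<in>Pair False ` K False. prob (A x))"
    by (simp add: probE prod.reindex inj_on_def)
  also have "\<dots> = (\<Prod>x\<in>Pair True ` K True \<union> Pair False ` K False. prob (A x))"
    by (rule prod.union_disjoint[symmetric]) (use K in auto)
  finally show "prob (\<Inter>x\<in>J. A x) = (\<Prod>x\<in>J. prob (A x))"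
    unfolding J_eq[symmetric] .
qed

text \<open>The tag \<open>True\<close> selects the sequence that supplies the first index of a pair, \<open>False\<close> the other one.
Boolean values make the law of each variable depend on its success probability
alone, which is what makes blocks at different places identically distributed.\<close>

locale bernoulli_pair = prob_space M for M :: "'a measure" +
  fixes Z :: "bool \<times> nat \<Rightarrow> 'a \<Rightarrow> bool" and p :: "bool \<Rightarrow> real"
  assumes indep: "indep_vars (\<lambda>_. count_space UNIV) Z (UNIV \<times> {1..})"
    and prob_Z: "i \<ge> 1 \<Longrightarrow> prob {\<omega> \<in> space M. Z (s, i) \<omega>} = p s"
begin

lemma measurable_Z [measurable]: "i \<ge> 1 \<Longrightarrow> Z (s, i) \<in> measurable M (count_space UNIV)"
  using indep by (auto simp: indep_vars_def2)

lemma p_bounds: "0 \<le> p s" "p s \<le> 1"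
  using prob_Z[of 1 s, symmetric] by simp_all

lemma prob_all_Z:
  assumes "finite J" "J \<subseteq> UNIV \<times> {1..}"
  shows "prob {\<omega> \<in> space M. \<forall>x\<in>J. Z x \<omega>} = (\<Prod>x\<in>J. p (fst x))"
proof (cases "J = {}")
  case True
  then show ?thesis by (simp add: prob_space)
next
  case False
  have "prob (\<Inter>x\<in>J. Z x -` {True} \<inter> space M) = (\<Prod>x\<in>J. prob (Z x -` {True} \<inter> space M))"
    using indep by (rule indep_varsD) (use assms False in auto)
  moreover have "(\<Inter>x\<in>J. Z x -` {True} \<inter> space M) = {\<omega> \<in> space M. \<forall>x\<in>J. Z x \<omega>}"
    using False by auto
  moreover have "prob (Z x -` {True} \<inter> space M) = p (fst x)" if "x \<in> J" for x
  proof -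
    have "Z x -` {True} \<inter> space M = {\<omega> \<in> space M. Z (fst x, snd x) \<omega>}"
      by auto
    then show ?thesis using prob_Z[of "snd x" "fst x"] assms(2) that by auto
  qed
  ultimately show ?thesis by (simp cong: prod.cong)
qed

definition hit :: "nat \<times> nat \<Rightarrow> 'a \<Rightarrow> bool" where
  "hit x \<omega> \<longleftrightarrow> Z (True, fst x) \<omega> \<and> Z (False, snd x) \<omega>"

definition q :: real where "q = p True * p False"

definition dev :: "nat \<times> nat \<Rightarrow> 'a \<Rightarrow> real" where
  "dev x \<omega> = of_bool (hit x \<omega>) - q"

abbreviation positive_pairs :: "(nat \<times> nat) set" where
  "positive_pairs \<equiv> {1..} \<times> {1..}"

lemma measurable_hit [measurable]: "x \<in> positive_pairs \<Longrightarrow> Measurable.pred M (hit x)"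
  unfolding hit_def by (cases x) simp

lemma measurable_dev [measurable]: "x \<in> positive_pairs \<Longrightarrow> dev x \<in> borel_measurable M"
  unfolding dev_def by measurable

lemma prob_hit: "x \<in> positive_pairs \<Longrightarrow> prob {\<omega> \<in> space M. hit x \<omega>} = q"
  using prob_all_Z[of "{(True, fst x), (False, snd x)}"] by (auto simp: hit_def q_def)

section \<open>Second moments of sums of centred hits\<close>

text \<open>Two distinct pairs with a common first index have covariance \<open>cov_row\<close>, two distinct pairs with
a common second index have covariance \<open>cov_col\<close>, and \<open>cov_rest\<close> is what remains of the
variance \<open>q * (1 - q)\<close> of a single hit after subtracting both. All three are
nonnegative, so second moments can be bounded from above by enlarging the row and column counts and from below
by dropping pairs.\<close>

definition cov_row :: real where "cov_row = p True * (p False)\<^sup>2 * (1 - p True)"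
definition cov_col :: real where "cov_col = (p True)\<^sup>2 * p False * (1 - p False)"
definition cov_rest :: real where "cov_rest = p True * p False * (1 - p True) * (1 - p False)"

lemma cov_nonneg: "0 \<le> cov_row" "0 \<le> cov_col" "0 \<le> cov_rest"
  using p_bounds by (simp_all add: cov_row_def cov_col_def cov_rest_def)

lemma prob_two_hits:
  assumes "x \<in> positive_pairs" "y \<in> positive_pairs"
  shows "prob {\<omega> \<in> space M. hit x \<omega> \<and> hit y \<omega>} = q\<^sup>2
    + of_bool (x = y) * cov_rest + of_bool (fst y = fst x) * cov_row + of_bool (snd y = snd x) * cov_col"
proof -
  have "prob {\<omega> \<in> space M. hit x \<omega> \<and> hit y \<omega>}
      = (\<Prod>z\<in>{(True, fst x), (False, snd x), (True, fst y), (False, snd y)}. p (fst z))"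
    using prob_all_Z[of "{(True, fst x), (False, snd x), (True, fst y), (False, snd y)}"] assms
    by (auto simp: hit_def conj_ac)
  also have "\<dots> = q\<^sup>2 + of_bool (x = y) * cov_rest + of_bool (fst y = fst x) * cov_row
      + of_bool (snd y = snd x) * cov_col"
    by (cases "fst y = fst x"; cases "snd y = snd x")
      (auto simp: prod_eq_iff insert_commute insert_absorb q_def cov_rest_def cov_row_def cov_col_def
        algebra_simps power2_eq_square)
  finally show ?thesis .
qed

lemma integrable_dev: "x \<in> positive_pairs \<Longrightarrow> integrable M (dev x)"
  unfolding dev_def by (intro Bochner_Integration.integrable_diff has_expectation_of_bool) auto

lemma expectation_dev: "x \<in> positive_pairs \<Longrightarrow> expectation (dev x) = 0"
  unfolding dev_def
  by (subst Bochner_Integration.integral_diff) (auto simp: has_expectation_of_bool prob_hit prob_space)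

lemma dev_mult:
  assumes "x \<in> positive_pairs" "y \<in> positive_pairs"
  shows "integrable M (\<lambda>\<omega>. dev x \<omega> * dev y \<omega>)"
    and "expectation (\<lambda>\<omega>. dev x \<omega> * dev y \<omega>) =
      of_bool (x = y) * cov_rest + of_bool (fst y = fst x) * cov_row + of_bool (snd y = snd x) * cov_col"
proof -
  have eq: "dev x \<omega> * dev y \<omega> =
      of_bool (hit x \<omega> \<and> hit y \<omega>) - q * of_bool (hit x \<omega>) - q * of_bool (hit y \<omega>) + q\<^sup>2" for \<omega>
    by (auto simp: dev_def algebra_simps power2_eq_square)
  have [measurable]: "Measurable.pred M (hit x)" "Measurable.pred M (hit y)"
    using assms by (auto intro: measurable_hit)
  have [simp]: "integrable M (\<lambda>\<omega>. of_bool (hit x \<omega>) :: real)" "integrable M (\<lambda>\<omega>. of_bool (hit y \<omega>) :: real)"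
    "integrable M (\<lambda>\<omega>. of_bool (hit x \<omega> \<and> hit y \<omega>) :: real)"
    by (rule has_expectation_of_bool(1); measurable)+
  have [simp]: "expectation (\<lambda>\<omega>. of_bool (hit x \<omega> \<and> hit y \<omega>)) = prob {\<omega> \<in> space M. hit x \<omega> \<and> hit y \<omega>}"
    "expectation (\<lambda>\<omega>. of_bool (hit x \<omega>)) = q" "expectation (\<lambda>\<omega>. of_bool (hit y \<omega>)) = q"
    by (simp_all only: has_expectation_of_bool(2) prob_hit[OF assms(1)] prob_hit[OF assms(2)]
        \<open>Measurable.pred M (hit x)\<close> \<open>Measurable.pred M (hit y)\<close> pred_intros_logic)
  show "integrable M (\<lambda>\<omega>. dev x \<omega> * dev y \<omega>)"
    unfolding eq by (simp del: of_bool_conj)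
  show "expectation (\<lambda>\<omega>. dev x \<omega> * dev y \<omega>) =
      of_bool (x = y) * cov_rest + of_bool (fst y = fst x) * cov_row + of_bool (snd y = snd x) * cov_col"
    unfolding eq using assms by (simp del: of_bool_conj add: prob_space prob_two_hits power2_eq_square)
qed

definition total_dev :: "(nat \<times> nat) set \<Rightarrow> 'a \<Rightarrow> real" where
  "total_dev R \<omega> = (\<Sum>x\<in>R. dev x \<omega>)"

lemma measurable_total_dev [measurable]:
  "R \<subseteq> positive_pairs \<Longrightarrow> total_dev R \<in> borel_measurable M"
  unfolding total_dev_def by (intro borel_measurable_sum measurable_dev) auto

lemma expectation_total_dev: "R \<subseteq> positive_pairs \<Longrightarrow> expectation (total_dev R) = 0"
  unfolding total_dev_def
  by (subst Bochner_Integration.integral_sum) (auto intro!: integrable_dev sum.neutral expectation_dev)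

text \<open>Summing the covariances over a set of pairs only requires counting, for each pair, the members of
the set in its row and in its column.\<close>

lemma total_dev_second_moment:
  assumes "finite R" "R \<subseteq> positive_pairs"
  shows "integrable M (\<lambda>\<omega>. (total_dev R \<omega>)\<^sup>2)"
    and "expectation (\<lambda>\<omega>. (total_dev R \<omega>)\<^sup>2) =
      (\<Sum>x\<in>R. cov_rest + cov_row * real (card {y \<in> R. fst y = fst x})
                         + cov_col * real (card {y \<in> R. snd y = snd x}))"
proof -
  have eq: "(total_dev R \<omega>)\<^sup>2 = (\<Sum>x\<in>R. \<Sum>y\<in>R. dev x \<omega> * dev y \<omega>)" for \<omega>
    by (simp add: total_dev_def power2_eq_square sum_product)
  have int: "integrable M (\<lambda>\<omega>. dev x \<omega> * dev y \<omega>)" if "x \<in> R" "y \<in> R" for x y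
    using dev_mult(1) assms that by blast
  then show "integrable M (\<lambda>\<omega>. (total_dev R \<omega>)\<^sup>2)"
    unfolding eq by (intro Bochner_Integration.integrable_sum) auto
  have "expectation (\<lambda>\<omega>. (total_dev R \<omega>)\<^sup>2) = (\<Sum>x\<in>R. \<Sum>y\<in>R. expectation (\<lambda>\<omega>. dev x \<omega> * dev y \<omega>))"
    unfolding eq
    by (subst Bochner_Integration.integral_sum; (intro Bochner_Integration.integrable_sum int sum.cong refl)?)
      (auto intro!: Bochner_Integration.integral_sum int)
  also have "\<dots> = (\<Sum>x\<in>R. \<Sum>y\<in>R. of_bool (x = y) * cov_rest + of_bool (fst y = fst x) * cov_row
      + of_bool (snd y = snd x) * cov_col)"
    using assms by (intro sum.cong refl dev_mult) auto
  also have "\<dots> = (\<Sum>x\<in>R. cov_rest + cov_row * real (card {y \<in> R. fst y = fst x})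
                         + cov_col * real (card {y \<in> R. snd y = snd x}))"
  proof (rule sum.cong[OF refl])
    fix x assume x: "x \<in> R"
    have *: "(\<Sum>y\<in>R. of_bool (P y) * c) = c * real (card {y \<in> R. P y})" for P and c :: real
      using assms(1) by (simp add: of_bool_def if_distrib[of "\<lambda>u. u * c"] sum.If_cases Int_def cong: if_cong)
    have "{y \<in> R. x = y} = {x}" using x by auto
    then show "(\<Sum>y\<in>R. of_bool (x = y) * cov_rest + of_bool (fst y = fst x) * cov_row
      + of_bool (snd y = snd x) * cov_col) = cov_rest + cov_row * real (card {y \<in> R. fst y = fst x})
                         + cov_col * real (card {y \<in> R. snd y = snd x})"
      by (simp only: sum.distrib *) simp
  qed
  finally show "expectation (\<lambda>\<omega>. (total_dev R \<omega>)\<^sup>2) =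
      (\<Sum>x\<in>R. cov_rest + cov_row * real (card {y \<in> R. fst y = fst x})
                         + cov_col * real (card {y \<in> R. snd y = snd x}))" .
qed

abbreviation limit_var :: "nat \<Rightarrow> real" where
  "limit_var \<delta> \<equiv> sigma_sq (p True) (p False) \<delta>"

text \<open>The covariances of one pair with all pairs near the diagonal add up to this number when its row and its
column are complete.\<close>

definition pair_var :: "nat \<Rightarrow> real" where
  "pair_var \<delta> = cov_rest + (cov_row + cov_col) * (2 * real \<delta> + 1)"

text \<open>A window of length \<open>n\<close> has about \<open>(2\<delta> + 1) * n\<close> pairs, so this identity explains the value
of the limit variance.\<close>

lemma limit_var_eq: "limit_var \<delta> = (2 * real \<delta> + 1) * pair_var \<delta>"
  by (simp add: sigma_sq_def pair_var_def cov_rest_def cov_row_def cov_col_def algebra_simps power2_eq_square)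

lemma pair_var_nonneg: "0 \<le> pair_var \<delta>"
  using cov_nonneg by (simp add: pair_var_def)

lemma limit_var_nonneg: "0 \<le> limit_var \<delta>"
  using pair_var_nonneg by (simp add: limit_var_eq)

lemma window_positive: "window \<delta> m n \<subseteq> positive_pairs"
  by (auto simp: window_def)

text \<open>The second moment grows at most linearly in the number of pairs, because each pair is correlated only with its own row and
column. This makes sparse sets of pairs negligible.\<close>

lemma total_dev_second_moment_le:
  assumes R: "R \<subseteq> window \<delta> m n"
  shows "expectation (\<lambda>\<omega>. (total_dev R \<omega>)\<^sup>2) \<le> real (card R) * pair_var \<delta>"
proof -
  have fin: "finite R" using R finite_window by (rule finite_subset)
  have "expectation (\<lambda>\<omega>. (total_dev R \<omega>)\<^sup>2) =
      (\<Sum>x\<in>R. cov_rest + cov_row * real (card {y \<in> R. fst y = fst x})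
                         + cov_col * real (card {y \<in> R. snd y = snd x}))"
    using fin R window_positive by (intro total_dev_second_moment) blast+
  also have "\<dots> \<le> (\<Sum>x\<in>R. pair_var \<delta>)"
  proof (rule sum_mono)
    fix x :: "nat \<times> nat"
    have "real (card {y \<in> R. fst y = fst x}) \<le> 2 * real \<delta> + 1"
      using of_nat_mono[OF card_row_le[OF R, of "fst x"], where 'a=real] by simp
    moreover have "real (card {y \<in> R. snd y = snd x}) \<le> 2 * real \<delta> + 1"
      using of_nat_mono[OF card_col_le[OF R, of "snd x"], where 'a=real] by simp
    ultimately show "cov_rest + cov_row * real (card {y \<in> R. fst y = fst x})
        + cov_col * real (card {y \<in> R. snd y = snd x}) \<le> pair_var \<delta>"
      using cov_nonneg unfolding pair_var_def
      by (simp add: distrib_right add_mono mult_left_mono)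
  qed
  finally show ?thesis by simp
qed

lemma window_second_moment_le:
  "expectation (\<lambda>\<omega>. (total_dev (window \<delta> m n) \<omega>)\<^sup>2) \<le> real n * limit_var \<delta>"
proof -
  have "expectation (\<lambda>\<omega>. (total_dev (window \<delta> m n) \<omega>)\<^sup>2) \<le> real (card (window \<delta> m n)) * pair_var \<delta>"
    by (rule total_dev_second_moment_le[OF order_refl])
  also have "\<dots> \<le> real ((2 * \<delta> + 1) * n) * pair_var \<delta>"
    by (intro mult_right_mono of_nat_mono card_window_le pair_var_nonneg)
  also have "\<dots> = real n * limit_var \<delta>"
    by (simp add: limit_var_eq algebra_simps)
  finally show ?thesis .
qed

lemma window_second_moment_ge:
  "(real n - 4 * real \<delta>) * limit_var \<delta> \<le> expectation (\<lambda>\<omega>. (total_dev (window \<delta> m n) \<omega>)\<^sup>2)"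
proof -
  let ?W = "window \<delta> m n"
  have "(real n - 4 * real \<delta>) * limit_var \<delta> \<le> real (n - 4 * \<delta>) * limit_var \<delta>"
    by (intro mult_right_mono limit_var_nonneg) linarith
  \<comment> \<open>Every pair of the core contributes the maximal amount; the other pairs of the window are dropped.\<close>
  also have "\<dots> = (\<Sum>x\<in>core \<delta> m n. pair_var \<delta>)"
    by (simp only: sum_constant card_core of_nat_mult limit_var_eq of_nat_add of_nat_1 of_nat_numeral)
      (simp only: mult_ac)
  also have "\<dots> = (\<Sum>x\<in>core \<delta> m n. cov_rest + cov_row * real (card {y \<in> ?W. fst y = fst x})
                         + cov_col * real (card {y \<in> ?W. snd y = snd x}))"
  proof (rule sum.cong[OF refl])
    fix x assume x: "x \<in> core \<delta> m n"
    show "pair_var \<delta> = cov_rest + cov_row * real (card {y \<in> ?W. fst y = fst x})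
                         + cov_col * real (card {y \<in> ?W. snd y = snd x})"
      unfolding card_row_core[OF x] card_col_core[OF x] by (simp add: pair_var_def algebra_simps)
  qed
  also have "\<dots> \<le> (\<Sum>x\<in>?W. cov_rest + cov_row * real (card {y \<in> ?W. fst y = fst x})
                         + cov_col * real (card {y \<in> ?W. snd y = snd x}))"
    by (rule sum_mono2) (use core_subset_window cov_nonneg in auto)
  also have "\<dots> = expectation (\<lambda>\<omega>. (total_dev ?W \<omega>)\<^sup>2)"
    by (rule total_dev_second_moment(2)[symmetric]) (use window_positive in auto)
  finally show ?thesis .
qed

section \<open>Independent blocks\<close>

text \<open>A law on the Booleans is determined by the probability of \<open>True\<close>.\<close>

lemma distr_Z_eq:
  assumes "i \<ge> 1" "j \<ge> 1"
  shows "distr M (count_space UNIV) (Z (s, i)) = distr M (count_space UNIV) (Z (s, j))"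
proof -
  have prob_True: "prob (Z (s, i) -` {True} \<inter> space M) = p s" if "i \<ge> 1" for i
    using prob_Z[OF that, of s] by (simp add: vimage_def Int_def conj_commute)
  have prob_False: "prob (Z (s, i) -` {False} \<inter> space M) = 1 - p s" if "i \<ge> 1" for i
  proof -
    have "Z (s, i) -` {False} \<inter> space M = space M - Z (s, i) -` {True} \<inter> space M"
      by auto
    then show ?thesis
      using prob_compl[of "Z (s, i) -` {True} \<inter> space M"] prob_True[OF that]
        measurable_sets[OF measurable_Z[OF that]] by simp
  qed
  show ?thesis
  proof (rule measure_eqI_finite[of _ UNIV])
    fix a :: bool
    show "emeasure (distr M (count_space UNIV) (Z (s, i))) {a} =
        emeasure (distr M (count_space UNIV) (Z (s, j))) {a}"
      using assms by (cases a) (simp_all add: emeasure_distr emeasure_eq_measure prob_True prob_False)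
  qed simp_all
qed

text \<open>Blocks are separated in the index set although their windows touch: a window uses only
variables whose indices lie inside the block. Hence no gaps between blocks are necessary.\<close>

lemma block_devs_indep:
  "indep_vars (\<lambda>_. borel) (\<lambda>b. total_dev (window \<delta> (b * k) k)) UNIV"
proof -
  define K where "K b = (UNIV :: bool set) \<times> {b * k<..b * k + k}" for b
  define g where "g b f = (\<Sum>x\<in>window \<delta> (b * k) k. of_bool (f (True, fst x) \<and> f (False, snd x)) - q)"
    for b and f :: "bool \<times> nat \<Rightarrow> bool"
  have "indep_vars (\<lambda>b. PiM (K b) (\<lambda>_. count_space UNIV)) (\<lambda>b \<omega>. restrict (\<lambda>x. Z x \<omega>) (K b)) UNIV"
  proof (rule indep_vars_restrict[OF indep])
    show "disjoint_family_on K UNIV"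
      unfolding disjoint_family_on_def K_def using block_index_unique by blast
  qed (auto simp: K_def)
  then have "indep_vars (\<lambda>_. borel) (\<lambda>b \<omega>. g b (restrict (\<lambda>x. Z x \<omega>) (K b))) UNIV"
  proof (rule indep_vars_compose2)
    fix b
    show "g b \<in> borel_measurable (PiM (K b) (\<lambda>_. count_space UNIV))"
      unfolding g_def
    proof (rule borel_measurable_sum)
      fix x assume "x \<in> window \<delta> (b * k) k"
      then have [measurable]: "(True, fst x) \<in> K b" "(False, snd x) \<in> K b"
        by (auto simp: window_def K_def)
      show "(\<lambda>f. of_bool (f (True, fst x) \<and> f (False, snd x)) - q)
          \<in> borel_measurable (PiM (K b) (\<lambda>_. count_space UNIV))"
        by measurable
    qed
  qed
  also have "(\<lambda>b \<omega>. g b (restrict (\<lambda>x. Z x \<omega>) (K b))) = (\<lambda>b. total_dev (window \<delta> (b * k) k))"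
    unfolding fun_eq_iff g_def total_dev_def dev_def hit_def
    by (auto intro!: sum.cong simp: K_def window_def)
  finally show ?thesis .
qed

text \<open>After shifting indices, every window is the same function of its variables, and these have the
same product law.\<close>

lemma distr_total_dev_window:
  assumes "k > 0"
  shows "distr M borel (total_dev (window \<delta> m k)) = distr M borel (total_dev (window \<delta> 0 k))"
proof -
  let ?N = "count_space (UNIV :: bool set)"
  define K where "K = (UNIV :: bool set) \<times> {0<..k}"
  define V where "V m x = Z (fst x, m + snd x)" for m and x :: "bool \<times> nat"
  define g where "g f = (\<Sum>x\<in>window \<delta> 0 k. of_bool (f (True, fst x) \<and> f (False, snd x)) - q)"
    for f :: "bool \<times> nat \<Rightarrow> bool"
  have K: "K \<noteq> {}" using assms by (auto simp: K_def)
  have g: "g \<in> borel_measurable (PiM K (\<lambda>_. ?N))"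
    unfolding g_def
  proof (rule borel_measurable_sum)
    fix x assume "x \<in> window \<delta> 0 k"
    then have [measurable]: "(True, fst x) \<in> K" "(False, snd x) \<in> K"
      by (auto simp: window_def K_def)
    show "(\<lambda>f. of_bool (f (True, fst x) \<and> f (False, snd x)) - q) \<in> borel_measurable (PiM K (\<lambda>_. ?N))"
      by measurable
  qed
  have V: "random_variable ?N (V m x)" if "x \<in> K" for m x
    using that unfolding V_def by (intro measurable_Z) (auto simp: K_def)
  have joint: "distr M (PiM K (\<lambda>_. ?N)) (\<lambda>\<omega>. \<lambda>x\<in>K. V m x \<omega>) = PiM K (\<lambda>x. distr M ?N (Z (fst x, 1)))"
    for m
  proof -
    have "indep_vars (\<lambda>x. PiM {(fst x, m + snd x)} (\<lambda>_. ?N))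
        (\<lambda>x \<omega>. restrict (\<lambda>y. Z y \<omega>) {(fst x, m + snd x)}) K"
      by (rule indep_vars_restrict[OF indep]) (auto simp: K_def disjoint_family_on_def)
    then have "indep_vars (\<lambda>_. ?N)
        (\<lambda>x \<omega>. (restrict (\<lambda>y. Z y \<omega>) {(fst x, m + snd x)}) (fst x, m + snd x)) K"
      by (rule indep_vars_compose2) simp
    then have "indep_vars (\<lambda>_. ?N) (V m) K"
      by (simp add: V_def[abs_def])
    then have "distr M (PiM K (\<lambda>_. ?N)) (\<lambda>\<omega>. \<lambda>x\<in>K. V m x \<omega>) = PiM K (\<lambda>x. distr M ?N (V m x))"
      using indep_vars_iff_distr_eq_PiM'[where X="V m", OF K V] by simp
    also have "\<dots> = PiM K (\<lambda>x. distr M ?N (Z (fst x, 1)))"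
      unfolding V_def by (intro PiM_cong refl distr_Z_eq) (auto simp: K_def)
    finally show ?thesis .
  qed
  have "distr M borel (total_dev (window \<delta> m k)) = distr (PiM K (\<lambda>x. distr M ?N (Z (fst x, 1)))) borel g"
    for m
  proof -
    have "total_dev (window \<delta> m k) \<omega> = g (\<lambda>x\<in>K. V m x \<omega>)" for \<omega>
      unfolding total_dev_def window_shift[of \<delta> m k]
      by (subst sum.reindex)
        (auto simp: inj_on_def g_def dev_def hit_def V_def K_def window_def intro!: sum.cong)
    then have "distr M borel (total_dev (window \<delta> m k)) = distr M borel (g \<circ> (\<lambda>\<omega>. \<lambda>x\<in>K. V m x \<omega>))"
      by (simp add: comp_def fun_eq_iff cong: distr_cong)
    also have "\<dots> = distr (distr M (PiM K (\<lambda>_. ?N)) (\<lambda>\<omega>. \<lambda>x\<in>K. V m x \<omega>)) borel g"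
      by (rule distr_distr[symmetric, OF g]) (auto intro!: measurable_restrict V)
    finally show ?thesis
      unfolding joint .
  qed
  then show ?thesis by metis
qed

lemma char_block_sum_tendsto:
  assumes "k > 0"
  shows "(\<lambda>n. char (distr M borel (\<lambda>\<omega>. (\<Sum>b<n. total_dev (window \<delta> (b * k) k) \<omega>) / sqrt n)) t)
    \<longlonglongrightarrow> complex_of_real (exp (- (expectation (\<lambda>\<omega>. (total_dev (window \<delta> 0 k) \<omega>)\<^sup>2) * t\<^sup>2) / 2))"
proof (rule char_iid_sum_tendsto[OF block_devs_indep])
  fix n
  show "expectation (total_dev (window \<delta> (n * k) k)) = 0"
    by (rule expectation_total_dev[OF window_positive])
  show "integrable M (\<lambda>\<omega>. (total_dev (window \<delta> (n * k) k) \<omega>)\<^sup>2)"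
    by (rule total_dev_second_moment(1)[OF finite_window window_positive])
  show distr: "distr M borel (total_dev (window \<delta> (n * k) k)) = distr M borel (total_dev (window \<delta> 0 k))"
    by (rule distr_total_dev_window[OF assms])
  have "expectation (\<lambda>\<omega>. (total_dev (window \<delta> m k) \<omega>)\<^sup>2)
      = (\<integral>x. x\<^sup>2 \<partial>distr M borel (total_dev (window \<delta> m k)))" for m
    by (rule integral_distr[symmetric]) (simp_all add: measurable_total_dev[OF window_positive])
  then show "expectation (\<lambda>\<omega>. (total_dev (window \<delta> (n * k) k) \<omega>)\<^sup>2)
      = expectation (\<lambda>\<omega>. (total_dev (window \<delta> 0 k) \<omega>)\<^sup>2)"
    by (simp only: distr)
qed

lemma window_second_moment_tendsto:
  "(\<lambda>k. expectation (\<lambda>\<omega>. (total_dev (window \<delta> 0 k) \<omega>)\<^sup>2) / k) \<longlonglongrightarrow> limit_var \<delta>"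
proof (rule tendsto_sandwich)
  show "\<forall>\<^sub>F k in sequentially. (1 - 4 * real \<delta> / real k) * limit_var \<delta>
      \<le> expectation (\<lambda>\<omega>. (total_dev (window \<delta> 0 k) \<omega>)\<^sup>2) / k"
    using eventually_gt_at_top[of 0]
  proof eventually_elim
    case (elim k)
    have "(1 - 4 * real \<delta> / real k) * limit_var \<delta> = (real k - 4 * real \<delta>) * limit_var \<delta> / k"
      using elim by (simp add: field_simps)
    then show ?case
      using window_second_moment_ge[of k \<delta> 0] by (simp add: divide_right_mono)
  qed
  show "\<forall>\<^sub>F k in sequentially. expectation (\<lambda>\<omega>. (total_dev (window \<delta> 0 k) \<omega>)\<^sup>2) / k \<le> limit_var \<delta>"
    using eventually_gt_at_top[of 0]
  proof eventually_elim
    case (elim k)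
    then show ?case
      using window_second_moment_le[of \<delta> 0 k] by (simp add: field_simps)
  qed
  have "(\<lambda>k. (1 - 4 * real \<delta> / real k) * limit_var \<delta>) \<longlonglongrightarrow> (1 - 0) * limit_var \<delta>"
    by (intro tendsto_intros tendsto_divide_0[OF tendsto_const] filterlim_at_top_imp_at_infinity
        filterlim_real_sequentially)
  then show "(\<lambda>k. (1 - 4 * real \<delta> / real k) * limit_var \<delta>) \<longlonglongrightarrow> limit_var \<delta>" by simp
qed simp

section \<open>Growing block length\<close>

text \<open>With \<open>U\<close> the pairs inside the blocks and \<open>R\<close> the remaining ones, the difference has two
sources: the neglected sum over \<open>R\<close>, which is of order \<open>k + 4\<delta>n\<close> in second moment, and the
replacement of \<open>sqrt T\<close> by \<open>sqrt (n * k)\<close>. For \<open>T \<ge> k\<^sup>2\<close> both are of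
order \<open>1 / k\<close>, since \<open>n / T \<le> 1 / k\<close> and \<open>k / T \<le> 1 / k\<close>.\<close>

lemma block_approximation:
  fixes \<delta> k T :: nat
  assumes k: "k > 0" and T: "T \<ge> k\<^sup>2"
  defines "n \<equiv> T div k"
  defines "F \<equiv> \<lambda>\<omega>. total_dev (window \<delta> 0 T) \<omega> / sqrt T"
    and "G \<equiv> \<lambda>\<omega>. (\<Sum>b<n. total_dev (window \<delta> (b * k) k) \<omega>) / sqrt n / sqrt k"
  shows "integrable M (\<lambda>\<omega>. (F \<omega> - G \<omega>)\<^sup>2)"
    and "expectation (\<lambda>\<omega>. (F \<omega> - G \<omega>)\<^sup>2) \<le> (8 * real \<delta> + 4) * limit_var \<delta> / k"
proof -
  define U where "U = (\<Union>b<n. window \<delta> (b * k) k)"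
  define R where "R = window \<delta> 0 T - U"
  have nk: "n * k \<le> T" and Tnk: "T < n * k + k"
    using div_mult_mod_eq[of T k] mod_less_divisor[OF k, of T] unfolding n_def by linarith+
  have "k * k \<le> T" using T by (simp add: power2_eq_square)
  then have "n \<ge> k"
    using k by (simp add: n_def div_greater_zero_iff less_eq_div_iff_mult_less_eq)
  then have n: "n > 0" using k by simp
  have "T > 0" using nk n k by (metis gr0I le_zero_eq mult_is_0 not_less0)
  have U: "U \<subseteq> window \<delta> 0 T"
    unfolding U_def by (rule blocks_subset[OF nk])
  then have finU: "finite U" by (rule finite_subset) simp
  have totalU: "total_dev U \<omega> = (\<Sum>b<n. total_dev (window \<delta> (b * k) k) \<omega>)" for \<omega>
    unfolding total_dev_def U_def by (rule sum.UNION_disjoint) (auto simp: blocks_disjoint)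
  have split: "total_dev (window \<delta> 0 T) \<omega> = total_dev U \<omega> + total_dev R \<omega>" for \<omega>
    unfolding total_dev_def R_def using sum.subset_diff[OF U finite_window] by (simp add: add.commute)
  \<comment> \<open>The error in the normalisation of the block sum.\<close>
  define c where "c = 1 / sqrt T - 1 / (sqrt n * sqrt k)"
  have diff: "F \<omega> - G \<omega> = total_dev R \<omega> / sqrt T + c * total_dev U \<omega>" for \<omega>
    by (simp add: F_def G_def split totalU[symmetric] c_def field_simps add_divide_distrib)
  have intU: "integrable M (\<lambda>\<omega>. (total_dev U \<omega>)\<^sup>2)"
    by (rule total_dev_second_moment(1)) (use finU U window_positive in blast)+
  have intR: "integrable M (\<lambda>\<omega>. (total_dev R \<omega>)\<^sup>2)"
    by (rule total_dev_second_moment(1)) (use window_positive in \<open>auto simp: R_def\<close>)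
  have [measurable]: "total_dev U \<in> borel_measurable M" "total_dev R \<in> borel_measurable M"
    using U window_positive[of \<delta> 0 T] by (auto intro!: measurable_total_dev simp: R_def)
  let ?B = "\<lambda>\<omega>. 2 * ((total_dev R \<omega>)\<^sup>2 / T) + 2 * (c\<^sup>2 * (total_dev U \<omega>)\<^sup>2)"
  have bound: "(F \<omega> - G \<omega>)\<^sup>2 \<le> ?B \<omega>" for \<omega>
  proof -
    have "(x + y)\<^sup>2 \<le> 2 * x\<^sup>2 + 2 * y\<^sup>2" for x y :: real
      using zero_le_power2[of "x - y"] by (simp add: power2_eq_square algebra_simps)
    from this[of "total_dev R \<omega> / sqrt T" "c * total_dev U \<omega>"] show ?thesis
      unfolding diff by (simp add: power_mult_distrib power_divide)
  qed
  have intB: "integrable M ?B" using intU intR by simp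
  show int: "integrable M (\<lambda>\<omega>. (F \<omega> - G \<omega>)\<^sup>2)"
  proof (rule Bochner_Integration.integrable_bound[OF intB])
    show "(\<lambda>\<omega>. (F \<omega> - G \<omega>)\<^sup>2) \<in> borel_measurable M"
      unfolding diff by measurable
    show "AE \<omega> in M. norm ((F \<omega> - G \<omega>)\<^sup>2) \<le> norm (?B \<omega>)"
      using bound by (auto intro!: AE_I2 order_trans[OF _ abs_ge_self])
  qed
  have real_nk: "real n * real k \<le> real T" and real_Tnk: "real T \<le> real n * real k + real k"
    using of_nat_mono[OF nk, where 'a=real] of_nat_mono[OF less_imp_le[OF Tnk], where 'a=real] by simp_all
  have kT: "real k / real T \<le> 1 / real k"
    using of_nat_mono[OF \<open>k * k \<le> T\<close>, where 'a=real] k \<open>T > 0\<close> by (simp add: field_simps)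
  have nT: "real n / real T \<le> 1 / real k"
    using real_nk k \<open>T > 0\<close> by (simp add: field_simps)
  have "expectation (\<lambda>\<omega>. (total_dev R \<omega>)\<^sup>2) \<le> real (card R) * pair_var \<delta>"
    by (rule total_dev_second_moment_le[of _ _ 0 T]) (simp add: R_def)
  also have "\<dots> \<le> ((2 * real \<delta> + 1) * (real k + 4 * real \<delta> * real n)) * pair_var \<delta>"
  proof (rule mult_right_mono[OF _ pair_var_nonneg])
    have "real (card R) \<le> (2 * real \<delta> + 1) * (real T - real n * real k + 4 * real \<delta> * real n)"
      using card_uncovered_pairs[OF nk, of \<delta>] by (simp only: R_def U_def)
    also have "\<dots> \<le> (2 * real \<delta> + 1) * (real k + 4 * real \<delta> * real n)"
      using real_Tnk by (intro mult_left_mono) auto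
    finally show "real (card R) \<le> (2 * real \<delta> + 1) * (real k + 4 * real \<delta> * real n)" .
  qed
  also have "\<dots> = (real k + 4 * real \<delta> * real n) * limit_var \<delta>"
    by (simp add: limit_var_eq)
  finally have "expectation (\<lambda>\<omega>. (total_dev R \<omega>)\<^sup>2) / T \<le> (real k + 4 * real \<delta> * real n) * limit_var \<delta> / T"
    by (rule divide_right_mono) simp
  also have "\<dots> = (real k / T + 4 * real \<delta> * (real n / T)) * limit_var \<delta>"
    by (simp add: add_divide_distrib distrib_right)
  also have "\<dots> \<le> (1 / k + 4 * real \<delta> * (1 / k)) * limit_var \<delta>"
    using kT nT by (intro mult_right_mono limit_var_nonneg add_mono mult_left_mono) auto
  finally have R_le: "expectation (\<lambda>\<omega>. (total_dev R \<omega>)\<^sup>2) / T \<le> (1 / k + 4 * real \<delta> * (1 / k)) * limit_var \<delta>" .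
  have U_le: "c\<^sup>2 * expectation (\<lambda>\<omega>. (total_dev U \<omega>)\<^sup>2) \<le> 1 / k * limit_var \<delta>"
  proof -
    have "card U \<le> n * ((2 * \<delta> + 1) * k)"
    proof -
      have "card U \<le> (\<Sum>b<n. card (window \<delta> (b * k) k))"
        unfolding U_def by (rule card_UN_le) simp
      also have "\<dots> \<le> (\<Sum>b<n. (2 * \<delta> + 1) * k)"
        by (intro sum_mono card_window_le)
      finally show ?thesis by simp
    qed
    then have "real (card U) * pair_var \<delta> \<le> real (n * ((2 * \<delta> + 1) * k)) * pair_var \<delta>"
      by (intro mult_right_mono of_nat_mono pair_var_nonneg)
    with total_dev_second_moment_le[OF U]
    have "expectation (\<lambda>\<omega>. (total_dev U \<omega>)\<^sup>2) \<le> real n * real k * limit_var \<delta>"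
      by (simp add: limit_var_eq algebra_simps)
    then have "c\<^sup>2 * expectation (\<lambda>\<omega>. (total_dev U \<omega>)\<^sup>2) \<le> c\<^sup>2 * (real n * real k * limit_var \<delta>)"
      by (rule mult_left_mono) simp
    also have "\<dots> = (c * sqrt (real n * real k))\<^sup>2 * limit_var \<delta>"
      by (simp add: power_mult_distrib)
    also have "c * sqrt (real n * real k) = sqrt (real n * real k / real T) - 1"
      using n k \<open>T > 0\<close> by (simp add: c_def left_diff_distrib real_sqrt_mult real_sqrt_divide)
    also have "(sqrt (real n * real k / real T) - 1)\<^sup>2 \<le> 1 / k"
    proof -
      define x where "x = real n * real k / real T"
      have x: "0 \<le> x" "x \<le> 1" using real_nk \<open>T > 0\<close> by (auto simp: x_def)
      \<comment> \<open>For \<open>x\<close> in the unit interval, \<open>(1 - sqrt x)\<^sup>2 \<le> (1 - sqrt x) * (1 + sqrt x) = 1 - x\<close>.\<close>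
      have "sqrt x * sqrt x \<le> sqrt x * 1"
        using x by (intro mult_left_mono) auto
      then have "(sqrt x - 1)\<^sup>2 \<le> 1 - x"
        using x by (simp add: power2_eq_square algebra_simps)
      also have "\<dots> = (real T - real n * real k) / T"
        using \<open>T > 0\<close> by (simp add: x_def diff_divide_distrib)
      also have "\<dots> \<le> real k / T"
        using real_Tnk by (intro divide_right_mono) auto
      finally show ?thesis using kT by (simp add: x_def)
    qed
    then have "(sqrt (real n * real k / real T) - 1)\<^sup>2 * limit_var \<delta> \<le> 1 / k * limit_var \<delta>"
      by (rule mult_right_mono[OF _ limit_var_nonneg])
    finally show ?thesis .
  qed
  have "expectation (\<lambda>\<omega>. (F \<omega> - G \<omega>)\<^sup>2) \<le> expectation ?B"
    by (rule integral_mono[OF int intB bound])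
  also have "\<dots> = 2 * (expectation (\<lambda>\<omega>. (total_dev R \<omega>)\<^sup>2) / T) + 2 * (c\<^sup>2 * expectation (\<lambda>\<omega>. (total_dev U \<omega>)\<^sup>2))"
    using intU intR by simp
  also have "\<dots> \<le> 2 * ((1 / k + 4 * real \<delta> * (1 / k)) * limit_var \<delta>) + 2 * (1 / k * limit_var \<delta>)"
    using R_le U_le by (intro add_mono mult_left_mono) auto
  also have "\<dots> = (8 * real \<delta> + 4) * limit_var \<delta> / k"
    by (simp add: algebra_simps add_divide_distrib)
  finally show "expectation (\<lambda>\<omega>. (F \<omega> - G \<omega>)\<^sup>2) \<le> (8 * real \<delta> + 4) * limit_var \<delta> / k" .
qed

lemma char_total_dev_tendsto:
  "(\<lambda>T. char (distr M borel (\<lambda>\<omega>. total_dev (window \<delta> 0 T) \<omega> / sqrt T)) t)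
     \<longlonglongrightarrow> complex_of_real (exp (- (limit_var \<delta> * t\<^sup>2) / 2))"
proof (rule tendsto_by_approximation)
  let ?G = "\<lambda>k n \<omega>. (\<Sum>b<n. total_dev (window \<delta> (b * k) k) \<omega>) / sqrt (real n)"
  let ?v = "\<lambda>k. expectation (\<lambda>\<omega>. (total_dev (window \<delta> 0 k) \<omega>)\<^sup>2)"
  fix k :: nat assume k: "k > 0"
  show "\<forall>\<^sub>F T in sequentially. dist (char (distr M borel (\<lambda>\<omega>. total_dev (window \<delta> 0 T) \<omega> / sqrt T)) t)
      (char (distr M borel (\<lambda>\<omega>. ?G k (T div k) \<omega> / sqrt k)) t)
      \<le> \<bar>t\<bar> * sqrt ((8 * real \<delta> + 4) * limit_var \<delta> / k)"
    using eventually_ge_at_top[of "k\<^sup>2"]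
  proof eventually_elim
    case (elim T)
    have [measurable]: "total_dev (window \<delta> m n) \<in> borel_measurable M" for m n
      by (rule measurable_total_dev[OF window_positive])
    show ?case
      unfolding dist_norm
      by (rule norm_char_diff_le[OF _ _ block_approximation[OF k elim]]) measurable
  qed
  \<comment> \<open>The factor \<open>1 / sqrt k\<close> is constant in \<open>T\<close> and moves into the argument of the characteristic function.\<close>
  have "(\<lambda>T. char (distr M borel (?G k (T div k))) (t / sqrt k))
      \<longlonglongrightarrow> complex_of_real (exp (- (?v k * (t / sqrt k)\<^sup>2) / 2))"
    using filterlim_compose[OF char_block_sum_tendsto[OF k] filterlim_at_top_div_const_nat[OF k]] .
  moreover have "char (distr M borel (?G k n)) (t / sqrt k) = char (distr M borel (\<lambda>\<omega>. ?G k n \<omega> / sqrt k)) t"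
    for n
  proof -
    have [measurable]: "total_dev (window \<delta> m n) \<in> borel_measurable M" for m n
      by (rule measurable_total_dev[OF window_positive])
    have "?G k n \<in> borel_measurable M" "(\<lambda>\<omega>. ?G k n \<omega> / sqrt k) \<in> borel_measurable M"
      by measurable
    moreover have "t / sqrt k * (x / sqrt n) = t * (x / sqrt n / sqrt k)" for x :: real
      by simp
    ultimately show ?thesis
      by (simp only: char_distr_eq)
  qed
  ultimately show "(\<lambda>T. char (distr M borel (\<lambda>\<omega>. ?G k (T div k) \<omega> / sqrt k)) t)
      \<longlonglongrightarrow> complex_of_real (exp (- (?v k / k * t\<^sup>2) / 2))"
    by (simp add: power_divide)
next
  have "(\<lambda>k. \<bar>t\<bar> * sqrt ((8 * real \<delta> + 4) * limit_var \<delta> / real k)) \<longlonglongrightarrow> \<bar>t\<bar> * sqrt 0"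
    by (intro tendsto_intros tendsto_divide_0[OF tendsto_const] filterlim_at_top_imp_at_infinity
        filterlim_real_sequentially)
  then show "(\<lambda>k. \<bar>t\<bar> * sqrt ((8 * real \<delta> + 4) * limit_var \<delta> / real k)) \<longlonglongrightarrow> 0" by simp
  show "(\<lambda>k. complex_of_real (exp (- (expectation (\<lambda>\<omega>. (total_dev (window \<delta> 0 k) \<omega>)\<^sup>2) / k * t\<^sup>2) / 2)))
      \<longlonglongrightarrow> complex_of_real (exp (- (limit_var \<delta> * t\<^sup>2) / 2))"
    by (intro tendsto_intros window_second_moment_tendsto) simp
qed

lemma total_dev_weak_conv:
  "weak_conv_m (\<lambda>T. distr M borel (\<lambda>\<omega>. total_dev (window \<delta> 0 T) \<omega> / sqrt T)) (centered_normal (limit_var \<delta>))"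
proof (rule levy_continuity)
  have [measurable]: "total_dev (window \<delta> m n) \<in> borel_measurable M" for m n
    by (rule measurable_total_dev[OF window_positive])
  show "real_distribution (distr M borel (\<lambda>\<omega>. total_dev (window \<delta> 0 T) \<omega> / sqrt T))" for T
    by (rule real_distribution_distr) measurable
  show "real_distribution (centered_normal (limit_var \<delta>))"
    by (rule real_distribution_centered_normal[OF limit_var_nonneg])
  show "(\<lambda>T. char (distr M borel (\<lambda>\<omega>. total_dev (window \<delta> 0 T) \<omega> / sqrt T)) t)
      \<longlonglongrightarrow> char (centered_normal (limit_var \<delta>)) t" for t
    unfolding char_centered_normal[OF limit_var_nonneg] by (rule char_total_dev_tendsto)
qed

end

theorem theorem2p2:
  fixes M :: "'a measure"
    and X Y :: "nat \<Rightarrow> 'a \<Rightarrow> real"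
    and pX pY :: real
    and \<delta> :: nat
  assumes "prob_space M"
    and "pX \<in> {0..1}" and "pY \<in> {0..1}"
    and "iid_bernoulli M pX X"
    and "iid_bernoulli M pY Y"
    and "indep_seqs M X Y"
  shows "weak_conv_m
           (\<lambda>T. distr M borel
              (\<lambda>\<omega>. (real (card (S_set X Y T \<delta> \<omega>)) - (\<integral>\<omega>'. real (card (S_set X Y T \<delta> \<omega>')) \<partial>M))
                     / sqrt (real T)))
           (centered_normal (sigma_sq pX pY \<delta>))"
proof -
  interpret prob_space M by fact
  define W where "W x = (if fst x then X (snd x) else Y (snd x))" for x
  define Z where "Z x \<omega> \<longleftrightarrow> W x \<omega> = 1" for x \<omega>
  define p where "p s = (if s then pX else pY)" for s
  interpret bernoulli_pair M Z p
  proof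
    have "indep_vars (\<lambda>_. borel) W (UNIV \<times> {1..})"
    proof (rule indep_vars_combine)
      show "indep_vars (\<lambda>_. borel) (\<lambda>i. W (s, i)) {1..}" for s
        using assms(4,5) by (cases s) (simp_all add: W_def iid_bernoulli_def)
      show "indep_var (PiM {1..} (\<lambda>_. borel)) (\<lambda>\<omega>. \<lambda>i\<in>{1..}. W (True, i) \<omega>)
                      (PiM {1..} (\<lambda>_. borel)) (\<lambda>\<omega>. \<lambda>i\<in>{1..}. W (False, i) \<omega>)"
        using assms(6) by (simp add: W_def indep_seqs_def)
    qed
    then show "indep_vars (\<lambda>_. count_space UNIV) Z (UNIV \<times> {1..})"
      unfolding Z_def by (rule indep_vars_compose2[where Y="\<lambda>_ r. r = 1"]) measurable
    show "prob {\<omega> \<in> space M. Z (s, i) \<omega>} = p s" if "i \<ge> 1" for i s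
      using assms(4,5) that by (cases s) (simp_all add: Z_def W_def p_def iid_bernoulli_def bernoulli_rv_def)
  qed
  have card_S: "real (card (S_set X Y T \<delta> \<omega>)) = total_dev (window \<delta> 0 T) \<omega> + card (window \<delta> 0 T) * q"
    for T \<omega>
  proof -
    have "S_set X Y T \<delta> \<omega> = {x \<in> window \<delta> 0 T. hit x \<omega>}"
      by (auto simp: S_set_def window_def hit_def Z_def W_def)
    then show ?thesis
      by (simp add: total_dev_def dev_def sum_subtractf of_bool_def sum.If_cases Int_def)
  qed
  have int: "integrable M (total_dev (window \<delta> 0 T))" for T
    unfolding total_dev_def using window_positive
    by (intro Bochner_Integration.integrable_sum integrable_dev) blast
  have "(\<integral>\<omega>'. real (card (S_set X Y T \<delta> \<omega>')) \<partial>M) = card (window \<delta> 0 T) * q" for T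
    unfolding card_S using int expectation_total_dev[OF window_positive] by (simp add: prob_space)
  then show ?thesis
    using total_dev_weak_conv[of \<delta>] by (simp add: card_S p_def)
qed

end
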